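(* Let $j\geq 2$ be an integer and let $n,m\geq j$ be integers. Let $\varphi,\psi\in C^{1,1}([0,1]^2)$ satisfy $$\varphi\geq 0,\quad \varphi'_x\geq 0,\quad \psi\geq 0,\quad \psi'_y\geq 0\quad\text{on }[0,1]^2,$$ and $$t^{j-1}\varphi'_y(t,s)=s^{j-1}\psi'_x(t,s)\quad\text{for all }(t,s)\in[0,1]^2.$$ Let $f:[0,1]^2\to\mathbb{R}$ be the function given by $$f(x,y):=\int_0^x t^{j-1}\varphi(t,y)\,dt+\int_0^y s^{j-1}\psi(0,s)\,ds=\int_0^y s^{j-1}\psi(x,s)\,ds+\int_0^x t^{j-1}\varphi(t,0)\,dt$$ (the two expressions are equal under the hypotheses above). Then $f\in K_j^{[2]}$ and $$f(x,y)\leq B_{n,m,j}f(x,y)\leq B_{n,m}f(x,y)\quad\text{for all }(x,y)\in[0,1]^2.$$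
   Context: $\varphi'_x,\psi'_x$ and $\varphi'_y,\psi'_y$ denote the partial derivatives with respect to the first and the second variable, respectively. $C^{p,q}([0,1]^2)$ denotes the space of all real-valued functions on $[0,1]^2$ having continuous partial derivatives of order $p$ in the first variable, respectively $q$ in the second variable, i.e. all partial derivatives $\partial^{k+l}f/\partial x^k\partial y^l$ with $0\le k\le p$, $0\le l\le q$ exist and are continuous on $[0,1]^2$. $K_j^{[1]}$ is the set of all $f\in C[0,1]$ such that $f$ is increasing (in the weak sense, i.e. nondecreasing) and the function $g(x):=f(x^{1/j})$ is convex on $[0,1]$. $K_j^{[2]}$ is the set of all $f\in C([0,1]^2)$ such that $f(\cdot,y)\in K_j^{[1]}$ for every $y\in[0,1]$ and $f(x,\cdot)\in K_j^{[1]}$ for every $x\in[0,1]$. With $p_{n,i}(x)=\binom{n}{i}x^i(1-x)^{n-i}$, the bivariate Bernstein operator $B_{n,m}$ and the bivariate Aldaz-Kounchev-Render operator $B_{n,m,j}$ are defined for $f\in C([0,1]^2)$ by $$B_{n,m}f(x,y)=\sum_{i=0}^{n}\sum_{k=0}^{m}f\left(\frac{i}{n},\frac{k}{m}\right)p_{n,i}(x)p_{m,k}(y),\qquad B_{n,m,j}f(x,y)=\sum_{i=0}^{n}\sum_{k=0}^{m}f\left(t_{n,i}^j,t_{m,k}^j\right)p_{n,i}(x)p_{m,k}(y),$$ where $$t_{n,k}^j=\left(\frac{k(k-1)\cdots(k-j+1)}{n(n-1)\cdots(n-j+1)}\right)^{1/j}$$ (the superscript $j$ in $t_{n,k}^j$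 is an index, not a power). *)

theory Defs
  imports "HOL-Analysis.Analysis"
begin

abbreviation unit_square :: "(real \<times> real) set" where
  "unit_square \<equiv> {0..1} \<times> {0..1}"

text \<open>Partial derivatives on the unit square, one-sided on the boundary. They are meaningful only
  where the respective section is differentiable within \<open>{0..1}\<close>.\<close>

definition partial_x :: "(real \<times> real \<Rightarrow> real) \<Rightarrow> real \<times> real \<Rightarrow> real" where
  "partial_x f = (\<lambda>(x, y). vector_derivative (\<lambda>t. f (t, y)) (at x within {0..1}))"

definition partial_y :: "(real \<times> real \<Rightarrow> real) \<Rightarrow> real \<times> real \<Rightarrow> real" where
  "partial_y f = (\<lambda>(x, y). vector_derivative (\<lambda>s. f (x, s)) (at y within {0..1}))"

text \<open>The class \<open>C\<^sup>p\<^sup>,\<^sup>q\<close> on the unit square. The mixed partial derivative of order \<open>(k, l)\<close> is read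
  as \<open>l\<close> differentiations in the second variable followed by \<open>k\<close> in the first one. Existence
  is required separately, since \<open>partial_x\<close> and \<open>partial_y\<close> are total operators.\<close>

definition C_class :: "nat \<Rightarrow> nat \<Rightarrow> (real \<times> real \<Rightarrow> real) set" where
  "C_class p q = {f.
     (\<forall>l<q. \<forall>x\<in>{0..1}. \<forall>y\<in>{0..1}.
        (\<lambda>s. (partial_y ^^ l) f (x, s)) differentiable (at y within {0..1})) \<and>
     (\<forall>k<p. \<forall>l\<le>q. \<forall>x\<in>{0..1}. \<forall>y\<in>{0..1}.
        (\<lambda>t. (partial_x ^^ k) ((partial_y ^^ l) f) (t, y)) differentiable (at x within {0..1})) \<and>
     (\<forall>k\<le>p. \<forall>l\<le>q. continuous_on unit_square ((partial_x ^^ k) ((partial_y ^^ l) f)))}"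

definition K1 :: "nat \<Rightarrow> (real \<Rightarrow> real) set" where
  "K1 j = {f. continuous_on {0..1} f \<and> mono_on {0..1} f \<and>
              convex_on {0..1} (\<lambda>x. f (root j x))}"

definition K2 :: "nat \<Rightarrow> (real \<times> real \<Rightarrow> real) set" where
  "K2 j = {f. continuous_on unit_square f \<and>
              (\<forall>y\<in>{0..1}. (\<lambda>x. f (x, y)) \<in> K1 j) \<and>
              (\<forall>x\<in>{0..1}. (\<lambda>y. f (x, y)) \<in> K1 j)}"

text \<open>The factors are subtracted in the reals; for \<open>k < j\<close> one of them vanishes and the node is \<open>0\<close>.\<close>

definition AKR_node :: "nat \<Rightarrow> nat \<Rightarrow> nat \<Rightarrow> real" where
  "AKR_node j n k =
     root j ((\<Prod>i<j. real k - real i) / (\<Prod>i<j. real n - real i))"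

definition bernstein_op :: "nat \<Rightarrow> nat \<Rightarrow> (real \<times> real \<Rightarrow> real) \<Rightarrow> real \<times> real \<Rightarrow> real" where
  "bernstein_op n m f = (\<lambda>(x, y).
     \<Sum>i\<le>n. \<Sum>k\<le>m. f (real i / real n, real k / real m) * Bernstein n i x * Bernstein m k y)"

definition AKR_op :: "nat \<Rightarrow> nat \<Rightarrow> nat \<Rightarrow> (real \<times> real \<Rightarrow> real) \<Rightarrow> real \<times> real \<Rightarrow> real" where
  "AKR_op n m j f = (\<lambda>(x, y).
     \<Sum>i\<le>n. \<Sum>k\<le>m. f (AKR_node j n i, AKR_node j m k) * Bernstein n i x * Bernstein m k y)"

end

theory Submission
  imports Defs
begin

text \<open>
  The pair \<open>(t\<^sup>j\<^sup>-\<^sup>1 \<phi>, s\<^sup>j\<^sup>-\<^sup>1 \<psi>)\<close> is a vector field on the square, and the compatibility condition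
  says that it is closed. Hence it is the gradient of \<open>f\<close>, and the two expressions for \<open>f\<close> are its
  line integrals from the origin to \<open>(x, y)\<close> along the two sides of a rectangle, taken in either
  order. Consequently \<open>f\<close> has the partial derivatives \<open>x\<^sup>j\<^sup>-\<^sup>1 \<phi>\<close> and \<open>y\<^sup>j\<^sup>-\<^sup>1 \<psi>\<close>. A function of one
  variable with derivative \<open>x\<^sup>j\<^sup>-\<^sup>1 h(x)\<close>, where \<open>h\<close> is nonnegative and nondecreasing, is
  nondecreasing, and it is convex as a function of \<open>u = x\<^sup>j\<close>, because its derivative with respect
  to \<open>u\<close> is \<open>h / j\<close>; this is \<open>K1_if_derivative\<close>. Together with the joint continuity of \<open>f\<close>, which
  holds as its sections are uniformly Lipschitz, this gives membership in \<open>K2 j\<close>.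

  Both inequalities hold for all members of \<open>K2 j\<close>. The powers \<open>(t\<^sub>n\<^sub>,\<^sub>k)\<^sup>j\<close> of the nodes are the
  quotients of binomial coefficients \<open>(k choose j) / (n choose j)\<close>, whose mean with
  respect to the binomial distribution is exactly \<open>x\<^sup>j\<close>. Jensen's inequality in the variable
  \<open>u = x\<^sup>j\<close>, applied in one coordinate after the other, therefore yields the lower bound \<open>f\<close>. Since
  \<open>t\<^sub>n\<^sub>,\<^sub>k \<le> k/n\<close> and \<open>f\<close> is nondecreasing in each coordinate, the two operators compare term by term.
\<close>

section \<open>Functions with derivative \<open>x\<^sup>j\<^sup>-\<^sup>1 h(x)\<close>\<close>

lemma nonneg_derivative_imp_le:
  fixes f :: "real \<Rightarrow> real"
  assumes "a \<le> b" and sub: "{a..b} \<subseteq> S"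
    and der: "\<And>x. x \<in> {a..b} \<Longrightarrow> (f has_real_derivative f' x) (at x within S)"
    and nonneg: "\<And>x. x \<in> {a..b} \<Longrightarrow> f' x \<ge> 0"
  shows "f a \<le> f b"
proof -
  have "(f has_derivative (*) (f' x)) (at x within {a..b})" if "a \<le> x" "x \<le> b" for x
    using DERIV_subset[OF der[of x] sub] that unfolding has_field_derivative_def by simp
  from mvt_very_simple[OF \<open>a \<le> b\<close> this]
  obtain x where "x \<in> {a..b}" "f b - f a = f' x * (b - a)" by blast
  moreover from this nonneg[of x] have "f' x * (b - a) \<ge> 0"
    using \<open>a \<le> b\<close> by simp
  ultimately show ?thesis by linarith
qed

lemma convex_on_if_subgradient:
  fixes g :: "real \<Rightarrow> real"
  assumes "convex S" and sub: "\<And>u v. u \<in> S \<Longrightarrow> v \<in> S \<Longrightarrow> g u + k u * (v - u) \<le> g v"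
  shows "convex_on S g"
proof (rule convex_onI[OF _ \<open>convex S\<close>])
  fix t x y :: real
  assume t: "0 < t" "t < 1" and xy: "x \<in> S" "y \<in> S"
  define z where "z = (1 - t) *\<^sub>R x + t *\<^sub>R y"
  have z: "z \<in> S"
    using convexD_alt[OF \<open>convex S\<close> xy, of t] t by (simp add: z_def)
  have "(1 - t) * (g z + k z * (x - z)) + t * (g z + k z * (y - z)) \<le> (1 - t) * g x + t * g y"
    using sub[OF z xy(1)] sub[OF z xy(2)] t by (intro add_mono mult_left_mono) auto
  moreover have "(1 - t) * (g z + k z * (x - z)) + t * (g z + k z * (y - z)) = g z"
    by (simp add: z_def algebra_simps)
  ultimately show "g ((1 - t) *\<^sub>R x + t *\<^sub>R y) \<le> (1 - t) * g x + t * g y"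
    by (simp add: z_def)
qed

text \<open>The chain rule shows that \<open>u \<mapsto> g(u\<^sup>1\<^sup>/\<^sup>j)\<close> has the nondecreasing derivative \<open>h(u\<^sup>1\<^sup>/\<^sup>j) / j\<close>
  for \<open>u > 0\<close>. For \<open>j \<ge> 2\<close> the root is not differentiable at \<open>0\<close>, so this slope is instead verified
  to be a subgradient: in the variable \<open>x = u\<^sup>1\<^sup>/\<^sup>j\<close>, the function \<open>g(x) - h(a) x\<^sup>j / j\<close> has
  derivative \<open>x\<^sup>j\<^sup>-\<^sup>1 (h(x) - h(a))\<close>, which is nonpositive to the left of \<open>a\<close> and nonnegative to its
  right; its minimum is therefore attained at \<open>a\<close>.\<close>

lemma K1_if_derivative:
  fixes g h :: "real \<Rightarrow> real"
  assumes "j > 0"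
    and der: "\<And>x. x \<in> {0..1} \<Longrightarrow>
               (g has_real_derivative x ^ (j - 1) * h x) (at x within {0..1})"
    and nonneg: "\<And>x. x \<in> {0..1} \<Longrightarrow> h x \<ge> 0"
    and mono: "mono_on {0..1} h"
  shows "g \<in> K1 j"
proof -
  have cont: "continuous_on {0..1} g"
    using der by (rule DERIV_continuous_on)
  have g_mono: "mono_on {0..1} g"
  proof (rule mono_onI)
    fix x y :: real
    assume "x \<in> {0..1}" "y \<in> {0..1}" "x \<le> y"
    then show "g x \<le> g y"
      by (intro nonneg_derivative_imp_le[of x y "{0..1}" g "\<lambda>x. x ^ (j - 1) * h x"])
         (auto intro!: der nonneg mult_nonneg_nonneg simp del: One_nat_def)
  qed
  have tangent: "g a + h a / j * (b ^ j - a ^ j) \<le> g b" if ab: "a \<in> {0..1}" "b \<in> {0..1}" for a b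
  proof -
    define d where "d x = g x - h a / j * x ^ j" for x
    have d: "(d has_real_derivative x ^ (j - 1) * (h x - h a)) (at x within {0..1})"
      if "x \<in> {0..1}" for x
      unfolding d_def using \<open>j > 0\<close>
      by (auto intro!: derivative_eq_intros der that simp: field_simps)
    have h_le: "h u \<le> h v" if "u \<in> {0..1}" "v \<in> {0..1}" "u \<le> v" for u v
      using mono_onD[OF mono that] .
    have "d a \<le> d b"
    proof (cases "a \<le> b")
      case True
      then show ?thesis
        using ab by (intro nonneg_derivative_imp_le[of a b "{0..1}" d
            "\<lambda>x. x ^ (j - 1) * (h x - h a)"])
          (auto intro!: d mult_nonneg_nonneg h_le simp del: One_nat_def)
    next
      case False
      then have "- d b \<le> - d a"
        using ab by (intro nonneg_derivative_imp_le[of b a "{0..1}" "\<lambda>x. - d x"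
            "\<lambda>x. - (x ^ (j - 1) * (h x - h a))"])
          (auto intro!: DERIV_minus d mult_nonneg_nonpos h_le simp del: One_nat_def)
      then show ?thesis by simp
    qed
    then show ?thesis by (simp add: d_def algebra_simps)
  qed
  have "convex_on {0..1} (\<lambda>x. g (root j x))"
  proof (rule convex_on_if_subgradient[where k = "\<lambda>u. h (root j u) / j"])
    fix u v :: real
    assume "u \<in> {0..1}" "v \<in> {0..1}"
    with tangent[of "root j u" "root j v"] \<open>j > 0\<close>
    show "g (root j u) + h (root j u) / j * (v - u) \<le> g (root j v)"
      by simp
  qed auto
  with cont g_mono show ?thesis by (simp add: K1_def)
qed

section \<open>The nodes and the Bernstein inequalities\<close>

lemma AKR_node_eq:
  "AKR_node j n k = root j (real (k choose j) / real (n choose j))"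
proof -
  have "(\<Prod>i<j. real m - real i) = fact j * real (m choose j)" for m
    by (simp add: binomial_gbinomial gbinomial_prod_rev lessThan_atLeast0)
  then show ?thesis by (simp add: AKR_node_def)
qed

lemma AKR_node_range:
  assumes "j > 0" "j \<le> n" "k \<le> n"
  shows "AKR_node j n k \<in> {0..1}"
proof -
  have "real (k choose j) \<le> real (n choose j)"
    using binomial_right_mono[OF \<open>k \<le> n\<close>] by simp
  moreover have "real (n choose j) > 0"
    using assms by simp
  ultimately show ?thesis
    using \<open>j > 0\<close> by (simp add: AKR_node_eq)
qed

text \<open>For \<open>k \<ge> j\<close>, each of the \<open>j\<close> factors \<open>(k - i) / (n - i)\<close> of the power of the node is at
  most \<open>k / n\<close>.\<close>

lemma AKR_node_le:
  assumes "j > 0" "j \<le> n" "k \<le> n"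
  shows "AKR_node j n k \<le> real k / real n"
proof (cases "k < j")
  case True
  then show ?thesis using \<open>j > 0\<close> by (simp add: AKR_node_eq binomial_eq_0)
next
  case False
  have "(\<Prod>i<j. real k - real i) / (\<Prod>i<j. real n - real i)
      = (\<Prod>i<j. (real k - real i) / (real n - real i))"
    by (simp add: prod_dividef)
  also have "\<dots> \<le> (\<Prod>i<j. real k / real n)"
  proof (rule prod_mono)
    fix i assume "i \<in> {..<j}"
    then have "i < n" "i < k" using assms False by auto
    moreover have "real i * real k \<le> real i * real n"
      using assms by (intro mult_left_mono) auto
    ultimately show "0 \<le> (real k - real i) / (real n - real i) \<and>
        (real k - real i) / (real n - real i) \<le> real k / real n"
      by (auto simp: field_simps)
  qed
  also have "\<dots> = (real k / real n) ^ j" by simp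
  finally have "AKR_node j n k \<le> root j ((real k / real n) ^ j)"
    unfolding AKR_node_def using \<open>j > 0\<close> by simp
  also have "\<dots> = real k / real n"
    using \<open>j > 0\<close> by (simp add: real_root_power_cancel)
  finally show ?thesis .
qed

text \<open>Factorial moments of the binomial distribution: rewriting
  \<open>(n choose k) (k choose j) = (n choose j) (n - j choose k - j)\<close> leaves \<open>(n choose j) x\<^sup>j\<close> times the
  total mass of the binomial distribution with \<open>n - j\<close> trials.\<close>

lemma sum_choose_Bernstein:
  assumes "j \<le> n"
  shows "(\<Sum>k\<le>n. real (k choose j) * Bernstein n k x) = real (n choose j) * x ^ j"
proof -
  have "(\<Sum>k\<le>n. real (k choose j) * Bernstein n k x)
      = (\<Sum>k\<in>{0+j..(n-j)+j}. real (k choose j) * Bernstein n k x)"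
    using assms by (intro sum.mono_neutral_right) (auto simp: binomial_eq_0)
  also have "\<dots> = (\<Sum>l\<in>{0..n-j}. real (l + j choose j) * Bernstein n (l + j) x)"
    by (rule sum.shift_bounds_cl_nat_ivl)
  also have "\<dots> = (\<Sum>l\<in>{0..n-j}. real (n choose j) * x ^ j * Bernstein (n - j) l x)"
  proof (rule sum.cong[OF refl])
    fix l assume "l \<in> {0..n - j}"
    then have "(n choose (l + j)) * (l + j choose j) = (n choose j) * (n - j choose l)"
      using choose_mult[of j "l + j" n] assms by simp
    then have "real (n choose (l + j)) * real (l + j choose j)
             = real (n choose j) * real (n - j choose l)"
      by (metis of_nat_mult)
    then show "real (l + j choose j) * Bernstein n (l + j) x
        = real (n choose j) * x ^ j * Bernstein (n - j) l x"
      by (simp add: Bernstein_def power_add add.commute algebra_simps)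
  qed
  also have "\<dots> = real (n choose j) * x ^ j"
    by (simp flip: sum_distrib_left atMost_atLeast0)
  finally show ?thesis .
qed

text \<open>Jensen's inequality for \<open>u \<mapsto> g(u\<^sup>1\<^sup>/\<^sup>j)\<close> at the points \<open>(t\<^sub>n\<^sub>,\<^sub>k)\<^sup>j\<close>, whose mean is \<open>x\<^sup>j\<close>.\<close>

lemma K1_le_AKR_sum:
  assumes "j > 0" "j \<le> n" and g: "g \<in> K1 j" and x: "x \<in> {0..1}"
  shows "g x \<le> (\<Sum>k\<le>n. g (AKR_node j n k) * Bernstein n k x)"
proof -
  let ?u = "\<lambda>k. real (k choose j) / real (n choose j)"
  have pos: "real (n choose j) > 0" using assms by simp
  have "(\<Sum>k\<le>n. Bernstein n k x *\<^sub>R ?u k)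
      = (\<Sum>k\<le>n. real (k choose j) * Bernstein n k x) / real (n choose j)"
    by (simp add: sum_divide_distrib mult.commute)
  also have "\<dots> = x ^ j"
    using pos by (simp only: sum_choose_Bernstein[OF \<open>j \<le> n\<close>]) simp
  finally have mean: "(\<Sum>k\<le>n. Bernstein n k x *\<^sub>R ?u k) = x ^ j" .
  have "convex_on {0..1} (\<lambda>x. g (root j x))" using g by (simp add: K1_def)
  then have "g (root j (\<Sum>k\<le>n. Bernstein n k x *\<^sub>R ?u k))
      \<le> (\<Sum>k\<le>n. Bernstein n k x * g (root j (?u k)))"
    using x pos binomial_right_mono[of _ n j]
    by (intro convex_on_sum[where C = "{0..1}"]) (auto simp: Bernstein_nonneg)
  moreover have "root j (x ^ j) = x"
    using x \<open>j > 0\<close> by (simp add: real_root_power_cancel)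
  ultimately show ?thesis
    unfolding mean by (simp add: AKR_node_eq mult.commute)
qed

lemma K2_le_AKR_op:
  assumes j: "j > 0" "j \<le> n" "j \<le> m" and f: "f \<in> K2 j"
    and x: "x \<in> {0..1}" and y: "y \<in> {0..1}"
  shows "f (x, y) \<le> AKR_op n m j f (x, y)"
proof -
  have "f (x, y) \<le> (\<Sum>i\<le>n. f (AKR_node j n i, y) * Bernstein n i x)"
    using f y by (intro K1_le_AKR_sum[OF j(1,2) _ x, where g = "\<lambda>x. f (x, y)"])
      (simp add: K2_def)
  also have "\<dots> \<le> (\<Sum>i\<le>n. (\<Sum>k\<le>m. f (AKR_node j n i, AKR_node j m k) * Bernstein m k y)
      * Bernstein n i x)"
  proof (intro sum_mono mult_right_mono)
    fix i assume "i \<in> {..n}"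
    then have "AKR_node j n i \<in> {0..1}" using j by (intro AKR_node_range) auto
    then show "f (AKR_node j n i, y)
        \<le> (\<Sum>k\<le>m. f (AKR_node j n i, AKR_node j m k) * Bernstein m k y)"
      using f by (intro K1_le_AKR_sum[OF j(1,3) _ y, where g = "\<lambda>y. f (AKR_node j n i, y)"])
        (simp add: K2_def)
  qed (use x in \<open>auto simp: Bernstein_nonneg\<close>)
  also have "\<dots> = AKR_op n m j f (x, y)"
    by (simp add: AKR_op_def sum_distrib_left sum_distrib_right mult_ac)
  finally show ?thesis .
qed

lemma K2_AKR_op_le_bernstein_op:
  assumes j: "j > 0" "j \<le> n" "j \<le> m" and f: "f \<in> K2 j"
    and x: "x \<in> {0..1}" and y: "y \<in> {0..1}"
  shows "AKR_op n m j f (x, y) \<le> bernstein_op n m f (x, y)"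
proof -
  have "f (AKR_node j n i, AKR_node j m k) \<le> f (real i / real n, real k / real m)"
    if "i \<le> n" "k \<le> m" for i k
  proof -
    have s: "AKR_node j n i \<in> {0..1}" and t: "AKR_node j m k \<in> {0..1}"
      using that j by (auto intro!: AKR_node_range simp del: atLeastAtMost_iff)
    have p: "real i / real n \<in> {0..1}" and q: "real k / real m \<in> {0..1}"
      using that j by (auto simp: divide_le_eq)
    have "f (AKR_node j n i, AKR_node j m k) \<le> f (real i / real n, AKR_node j m k)"
      using f t s p AKR_node_le[OF j(1,2) that(1)]
      by (auto simp: K2_def K1_def simp del: atLeastAtMost_iff dest: mono_onD)
    also have "\<dots> \<le> f (real i / real n, real k / real m)"
      using f t q p AKR_node_le[OF j(1,3) that(2)]
      by (auto simp: K2_def K1_def simp del: atLeastAtMost_iff dest: mono_onD)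
    finally show ?thesis .
  qed
  then show ?thesis
    using x y unfolding AKR_op_def bernstein_op_def prod.case
    by (intro sum_mono mult_right_mono) (auto simp: Bernstein_nonneg)
qed

section \<open>Partial derivatives on the square\<close>

lemma has_real_derivative_if_differentiable:
  fixes g :: "real \<Rightarrow> real"
  assumes "g differentiable F"
  shows "(g has_real_derivative vector_derivative g F) F"
  using assms by (simp add: vector_derivative_works has_real_derivative_iff_has_vector_derivative)

lemma C_class_1_1D:
  assumes "f \<in> C_class 1 1"
  shows "continuous_on unit_square f"
    and "continuous_on unit_square (partial_y f)"
    and "\<And>x y. x \<in> {0..1} \<Longrightarrow> y \<in> {0..1} \<Longrightarrow>
          ((\<lambda>t. f (t, y)) has_real_derivative partial_x f (x, y)) (at x within {0..1})"
    and "\<And>x y. x \<in> {0..1} \<Longrightarrow> y \<in> {0..1} \<Longrightarrow>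
          ((\<lambda>s. f (x, s)) has_real_derivative partial_y f (x, y)) (at y within {0..1})"
proof -
  note C = assms[unfolded C_class_def mem_Collect_eq]
  note dy = C[THEN conjunct1, rule_format]
    and dx = C[THEN conjunct2, THEN conjunct1, rule_format]
    and c = C[THEN conjunct2, THEN conjunct2, rule_format]
  show "continuous_on unit_square f" using c[of 0 0] by simp
  show "continuous_on unit_square (partial_y f)" using c[of 0 1] by simp
  fix x y :: real assume xy: "x \<in> {0..1}" "y \<in> {0..1}"
  have "(\<lambda>t. f (t, y)) differentiable (at x within {0..1})"
    using dx[of 0 0 x y] xy by simp
  then show "((\<lambda>t. f (t, y)) has_real_derivative partial_x f (x, y)) (at x within {0..1})"
    unfolding partial_x_def prod.case by (rule has_real_derivative_if_differentiable)
  have "(\<lambda>s. f (x, s)) differentiable (at y within {0..1})"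
    using dy[of 0 x y] xy by simp
  then show "((\<lambda>s. f (x, s)) has_real_derivative partial_y f (x, y)) (at y within {0..1})"
    unfolding partial_y_def prod.case by (rule has_real_derivative_if_differentiable)
qed

lemma continuous_on_sections:
  assumes "continuous_on unit_square f"
  shows "y \<in> {0..1} \<Longrightarrow> continuous_on {0..1} (\<lambda>x. f (x, y))"
    and "x \<in> {0..1} \<Longrightarrow> continuous_on {0..1} (\<lambda>y. f (x, y))"
  by (rule continuous_on_compose2[OF assms], rule continuous_intros, auto intro: continuous_intros)+

lemma integral_derivative_on_unit_interval:
  fixes g :: "real \<Rightarrow> real"
  assumes "\<And>x. x \<in> {0..1} \<Longrightarrow> (g has_real_derivative g' x) (at x within {0..1})"
    and "b \<in> {0..1}"
  shows "integral {0..b} g' = g b - g 0"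
proof (rule integral_unique, rule fundamental_theorem_of_calculus)
  fix x assume "x \<in> {0..b}"
  with assms(2) show "(g has_vector_derivative g' x) (at x within {0..b})"
    unfolding has_real_derivative_iff_has_vector_derivative[symmetric]
    by (intro DERIV_subset[OF assms(1)]) auto
qed (use assms(2) in auto)

text \<open>Green's formula for a closed field \<open>(a(t) \<phi>, b(s) \<psi>)\<close> on the rectangle with
  corners \<open>(0, 0)\<close> and \<open>(x, y)\<close>: both sides are the integral over the rectangle of
  \<open>a(t) \<phi>'\<^sub>y = b(s) \<psi>'\<^sub>x\<close>, so they agree by Fubini's theorem.\<close>

lemma closed_field_rectangle:
  fixes a b :: "real \<Rightarrow> real"
  assumes \<phi>: "\<phi> \<in> C_class 1 1" and \<psi>: "\<psi> \<in> C_class 1 1"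
    and a: "continuous_on {0..1} a" and b: "continuous_on {0..1} b"
    and closed: "\<And>t s. t \<in> {0..1} \<Longrightarrow> s \<in> {0..1} \<Longrightarrow>
                   a t * partial_y \<phi> (t, s) = b s * partial_x \<psi> (t, s)"
    and x: "x \<in> {0..1}" and y: "y \<in> {0..1}"
  shows "integral {0..x} (\<lambda>t. a t * \<phi> (t, y)) - integral {0..x} (\<lambda>t. a t * \<phi> (t, 0))
       = integral {0..y} (\<lambda>s. b s * \<psi> (x, s)) - integral {0..y} (\<lambda>s. b s * \<psi> (0, s))"
proof -
  note \<phi>D = C_class_1_1D[OF \<phi>] and \<psi>D = C_class_1_1D[OF \<psi>]
  have int_\<phi>: "(\<lambda>t. a t * \<phi> (t, v)) integrable_on {0..x}" if "v \<in> {0..1}" for v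
    using x continuous_on_subset[OF continuous_on_mult[OF a continuous_on_sections(1)[OF \<phi>D(1) that]]]
    by (intro integrable_continuous_interval) auto
  have int_\<psi>: "(\<lambda>s. b s * \<psi> (u, s)) integrable_on {0..y}" if "u \<in> {0..1}" for u
    using y continuous_on_subset[OF continuous_on_mult[OF b continuous_on_sections(2)[OF \<psi>D(1) that]]]
    by (intro integrable_continuous_interval) auto
  have "continuous_on (cbox (0, 0) (x, y)) (\<lambda>(t, s). a t * partial_y \<phi> (t, s))"
    using x y unfolding case_prod_beta prod.collapse cbox_Pair_eq
    by (intro continuous_on_mult continuous_on_compose2[OF a continuous_on_fst]
        continuous_on_id continuous_on_subset[OF \<phi>D(2)]) auto
  note swap = integral_swap_continuous[OF this]
  have "integral {0..x} (\<lambda>t. a t * \<phi> (t, y)) - integral {0..x} (\<lambda>t. a t * \<phi> (t, 0))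
      = integral {0..x} (\<lambda>t. a t * (\<phi> (t, y) - \<phi> (t, 0)))"
    using y by (subst integral_diff[symmetric]) (auto intro!: int_\<phi> simp: right_diff_distrib)
  also have "\<dots> = integral {0..x} (\<lambda>t. integral {0..y} (\<lambda>s. a t * partial_y \<phi> (t, s)))"
    using x integral_derivative_on_unit_interval[OF \<phi>D(4) y]
    by (intro integral_cong) auto
  also have "\<dots> = integral {0..y} (\<lambda>s. integral {0..x} (\<lambda>t. a t * partial_y \<phi> (t, s)))"
    using swap by simp
  also have "\<dots> = integral {0..y} (\<lambda>s. integral {0..x} (\<lambda>t. b s * partial_x \<psi> (t, s)))"
    using x y by (intro integral_cong closed) auto
  also have "\<dots> = integral {0..y} (\<lambda>s. b s * (\<psi> (x, s) - \<psi> (0, s)))"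
    using y integral_derivative_on_unit_interval[OF \<psi>D(3) x]
    by (intro integral_cong) auto
  also have "\<dots> = integral {0..y} (\<lambda>s. b s * \<psi> (x, s)) - integral {0..y} (\<lambda>s. b s * \<psi> (0, s))"
    using x by (subst integral_diff[symmetric]) (auto intro!: int_\<psi> simp: right_diff_distrib)
  finally show ?thesis .
qed

lemma has_derivative_of_integral_plus_const:
  fixes g h :: "real \<Rightarrow> real"
  assumes h: "continuous_on {0..1} h"
    and g: "\<And>x. x \<in> {0..1} \<Longrightarrow> g x = integral {0..x} h + c"
    and x: "x \<in> {0..1}"
  shows "(g has_real_derivative h x) (at x within {0..1})"
proof (rule has_field_derivative_transform_within)
  show "((\<lambda>x. integral {0..x} h + c) has_real_derivative h x) (at x within {0..1})"
    using integral_has_real_derivative[OF h x] by (auto intro!: derivative_eq_intros)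
qed (use x g in \<open>auto intro: zero_less_one\<close>)

text \<open>Continuity in each variable does not give joint continuity, but a bounded partial derivative
  makes one family of sections uniformly Lipschitz.\<close>

lemma continuous_on_unit_square_if_bounded_partial:
  fixes f :: "real \<times> real \<Rightarrow> real"
  assumes cont: "\<And>y. y \<in> {0..1} \<Longrightarrow> continuous_on {0..1} (\<lambda>x. f (x, y))"
    and der: "\<And>x y. x \<in> {0..1} \<Longrightarrow> y \<in> {0..1} \<Longrightarrow>
               ((\<lambda>y. f (x, y)) has_real_derivative d (x, y)) (at y within {0..1})"
    and bound: "\<And>z. z \<in> unit_square \<Longrightarrow> \<bar>d z\<bar> \<le> M"
  shows "continuous_on unit_square f"
proof -
  have "M \<ge> 0" using bound[of "(0, 0)"] by auto
  have lip: "M-lipschitz_on {0..1} (\<lambda>y. f (x, y))" if "x \<in> {0..1}" for x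
  proof (rule lipschitz_onI)
    fix u v :: real assume "u \<in> {0..1}" "v \<in> {0..1}"
    then show "dist (f (x, u)) (f (x, v)) \<le> M * dist u v"
      unfolding dist_norm using that bound
      by (intro field_differentiable_bound[of "{0..1}" "\<lambda>y. f (x, y)" "\<lambda>y. d (x, y)"] der) auto
  qed (fact \<open>M \<ge> 0\<close>)
  have "local_lipschitz {0..1} {0..1} (\<lambda>x y. f (x, y))"
    by (rule local_lipschitzI, rule exI[of _ 1]) (auto intro!: exI[of _ M] lipschitz_on_subset[OF lip])
  from continuous_on_TimesI[OF this cont] show ?thesis by simp
qed

theorem theorem4p2:
  fixes j n m :: nat
    and \<phi> \<psi> f :: "real \<times> real \<Rightarrow> real"
  assumes "j \<ge> 2" and "n \<ge> j" and "m \<ge> j"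
    and "\<phi> \<in> C_class 1 1" and "\<psi> \<in> C_class 1 1"
    and "\<forall>z\<in>unit_square. \<phi> z \<ge> 0"
    and "\<forall>z\<in>unit_square. partial_x \<phi> z \<ge> 0"
    and "\<forall>z\<in>unit_square. \<psi> z \<ge> 0"
    and "\<forall>z\<in>unit_square. partial_y \<psi> z \<ge> 0"
    and "\<forall>t\<in>{0..1}. \<forall>s\<in>{0..1}.
           t ^ (j - 1) * partial_y \<phi> (t, s) = s ^ (j - 1) * partial_x \<psi> (t, s)"
    and "\<forall>x\<in>{0..1}. \<forall>y\<in>{0..1}.
           f (x, y) = integral {0..x} (\<lambda>t. t ^ (j - 1) * \<phi> (t, y))
                    + integral {0..y} (\<lambda>s. s ^ (j - 1) * \<psi> (0, s))"
  shows "(\<forall>x\<in>{0..1}. \<forall>y\<in>{0..1}.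
           f (x, y) = integral {0..y} (\<lambda>s. s ^ (j - 1) * \<psi> (x, s))
                    + integral {0..x} (\<lambda>t. t ^ (j - 1) * \<phi> (t, 0)))
    \<and> f \<in> K2 j
    \<and> (\<forall>x\<in>{0..1}. \<forall>y\<in>{0..1}.
           f (x, y) \<le> AKR_op n m j f (x, y) \<and>
           AKR_op n m j f (x, y) \<le> bernstein_op n m f (x, y))"
proof -
  note \<phi>D = C_class_1_1D[OF assms(4)] and \<psi>D = C_class_1_1D[OF assms(5)]
  have "j > 0" using \<open>j \<ge> 2\<close> by simp
  have cont_power: "continuous_on {0..1} (\<lambda>t::real. t ^ (j - 1))"
    by (intro continuous_intros)
  have f_y: "f (x, y) = integral {0..y} (\<lambda>s. s ^ (j - 1) * \<psi> (x, s))
                      + integral {0..x} (\<lambda>t. t ^ (j - 1) * \<phi> (t, 0))"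
    if "x \<in> {0..1}" "y \<in> {0..1}" for x y
  proof -
    have "integral {0..x} (\<lambda>t. t ^ (j - 1) * \<phi> (t, y)) - integral {0..x} (\<lambda>t. t ^ (j - 1) * \<phi> (t, 0))
        = integral {0..y} (\<lambda>s. s ^ (j - 1) * \<psi> (x, s)) - integral {0..y} (\<lambda>s. s ^ (j - 1) * \<psi> (0, s))"
      by (rule closed_field_rectangle[OF assms(4,5) cont_power cont_power _ that]) (use assms(10) in blast)
    then show ?thesis
      using assms(11)[rule_format, OF that] by linarith
  qed
  have f'x: "((\<lambda>x. f (x, y)) has_real_derivative x ^ (j - 1) * \<phi> (x, y)) (at x within {0..1})"
    if x: "x \<in> {0..1}" and y: "y \<in> {0..1}" for x y
    by (rule has_derivative_of_integral_plus_const[OF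
          continuous_on_mult[OF cont_power continuous_on_sections(1)[OF \<phi>D(1) y]] _ x])
       (rule assms(11)[rule_format, OF _ y])
  have f'y: "((\<lambda>y. f (x, y)) has_real_derivative y ^ (j - 1) * \<psi> (x, y)) (at y within {0..1})"
    if x: "x \<in> {0..1}" and y: "y \<in> {0..1}" for x y
    by (rule has_derivative_of_integral_plus_const[OF
          continuous_on_mult[OF cont_power continuous_on_sections(2)[OF \<psi>D(1) x]] _ y])
       (rule f_y[OF x])
  have K1x: "(\<lambda>x. f (x, y)) \<in> K1 j" if y: "y \<in> {0..1}" for y
  proof (rule K1_if_derivative[OF \<open>j > 0\<close> f'x])
    show "mono_on {0..1} (\<lambda>x. \<phi> (x, y))"
      using assms(7) y by (intro mono_onI nonneg_derivative_imp_le[OF _ _ \<phi>D(3)]) auto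
  qed (use assms(6) y in auto)
  have K1y: "(\<lambda>y. f (x, y)) \<in> K1 j" if x: "x \<in> {0..1}" for x
  proof (rule K1_if_derivative[OF \<open>j > 0\<close> f'y])
    show "mono_on {0..1} (\<lambda>y. \<psi> (x, y))"
      using assms(9) x by (intro mono_onI nonneg_derivative_imp_le[OF _ _ \<psi>D(4)]) auto
  qed (use assms(8) x in auto)
  have "continuous_on unit_square (\<lambda>z. snd z ^ (j - 1) * \<psi> z)"
    by (intro continuous_intros \<psi>D(1))
  then have "bounded ((\<lambda>z. snd z ^ (j - 1) * \<psi> z) ` unit_square)"
    by (intro compact_imp_bounded compact_continuous_image compact_Times compact_Icc)
  then obtain M where M: "\<And>z. z \<in> unit_square \<Longrightarrow> \<bar>snd z ^ (j - 1) * \<psi> z\<bar> \<le> M"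
    unfolding bounded_iff real_norm_def by blast
  have "continuous_on unit_square f"
    by (rule continuous_on_unit_square_if_bounded_partial[OF _ _ M])
       (use K1x f'y in \<open>auto simp: K1_def\<close>)
  with K1x K1y have K2: "f \<in> K2 j" by (simp add: K2_def)
  then show ?thesis
    using f_y K2_le_AKR_op[OF \<open>j > 0\<close> assms(2,3) K2]
      K2_AKR_op_le_bernstein_op[OF \<open>j > 0\<close> assms(2,3) K2] by blast
qed

end
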